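(* Consider the statements (B-cp-ms) and (AI-lin-rsms) given in the context. Then (B-cp-ms) is deducible from (AI-lin-rsms), and (AI-lin-rsms) is deducible from (B-cp-ms). Hence (B-cp-ms) and (AI-lin-rsms) are mutually equivalent.
   Context: "Deducible from" means "implied by", each statement being universally quantified over all the data it mentions. For a map $T:X\to X$, $\mathrm{Fix}(T)=\{x\in X:Tx=x\}$. (B-cp-ms) (Banach contraction principle): for every nonempty set $X$, metric $d$ on $X$ and map $T:X\to X$, if $X$ is $d$-complete and there is $\alpha\in[0,1)$ with $d(Tx,Ty)\le\alpha d(x,y)$ for all $x,y\in X$, then $T$ is global strongly Picard (modulo $d$), i.e. for each $x\in X$ the sequence $(T^nx)_{n\ge0}$ is $d$-convergent with limit in $\mathrm{Fix}(T)$, and $z_1,z_2\in\mathrm{Fix}(T)$ implies $z_1=z_2$. (AI-lin-rsms): for every nonempty set $X$, metric $d$ on $X$, reflexive symmetric relation $\mathcal S\subseteq X\times X$ and map $T:X\to X$, if (i) $T$ is $(d,\mathcal S;\lambda)$-contractive for some $\lambda\in(0,1)$, (ii) $X$ is $(d,\mathcal S)$-complete and $\mathcal S$ is $d$-almost-selfclosed, (iii) $T$ is $\mathcal S$-increasing and $\mathcal S^\omega$-semi-progressive, then $T$ is $\mathcal S^\omega$-global strongly Picard (modulo $(d,\mathcal S^\omega)$). Definitions used. $x\mathcal S^\omega y$ iff there are $k\ge2$ and $z_1,\dots,z_k\in X$ with $z_1=x$, $z_k=y$, $z_i\mathcal S z_{i+1}$ for $1\le i\le k-1$. $T$ is $(d,\mathcal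 S;\lambda)$-contractive if $d(Tx,Ty)\le\lambda d(x,y)$ whenever $x\mathcal S y$. A sequence $(z_n)$ is $\mathcal S$-ascending if $z_i\mathcal S z_{i+1}$ for every $i$. $X$ is $(d,\mathcal S)$-complete if every $\mathcal S$-ascending $d$-Cauchy sequence is $d$-convergent in $X$. $\mathcal S$ is $d$-almost-selfclosed if, whenever $(z_n)$ is $\mathcal S$-ascending and $d$-converges to $z$, there is a subsequence $(w_n)$ of $(z_n)$ with $w_n\mathcal S z$ for all $n$. $T$ is $\mathcal S$-increasing if $x\mathcal S y$ implies $Tx\mathcal S Ty$. $X(T,\mathcal S^\omega)=\{x\in X: x\mathcal S^\omega Tx\}$; $T$ is $\mathcal S^\omega$-semi-progressive if this set is nonempty. $T$ is $\mathcal S^\omega$-global strongly Picard (modulo $(d,\mathcal S^\omega)$) if for each $x\in X(T,\mathcal S^\omega)$ the sequence $(T^nx)_{n\ge0}$ is $d$-convergent with limit in $\mathrm{Fix}(T)$, and for all $z_1,z_2\in\mathrm{Fix}(T)$, $z_1\mathcal S^\omega z_2$ implies $z_1=z_2$. *)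

theory Defs
  imports "HOL-Analysis.Analysis"
begin

text \<open>
  Spaces are carrier sets \<open>X\<close> inside a type, with the carrier-based metric notions of
  \<^locale>\<open>Metric_space\<close>. That locale also asks \<open>d\<close> to be nonnegative and symmetric off \<open>X\<close>,
  which excludes no metric on \<open>X\<close>: set \<open>d\<close> to 0 off \<open>X \<times> X\<close>. Values of \<open>T\<close> outside \<open>X\<close>
  are irrelevant. The two statements take a type argument because \<open>X\<close> ranges over all subsets
  of that type. \<open>rel_omega X S\<close> is \<open>S\<^sup>\<omega>\<close> and \<open>progress_set X T R\<close> is \<open>X(T, R)\<close>.
\<close>

definition Fix_set :: "'a set \<Rightarrow> ('a \<Rightarrow> 'a) \<Rightarrow> 'a set" where
  "Fix_set X T = {x \<in> X. T x = x}"

definition d_converges :: "'a set \<Rightarrow> ('a \<Rightarrow> 'a \<Rightarrow> real) \<Rightarrow> (nat \<Rightarrow> 'a) \<Rightarrow> 'a \<Rightarrow> bool" where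
  "d_converges X d s z \<longleftrightarrow> limitin (Metric_space.mtopology X d) s z sequentially"

definition global_strongly_Picard ::
    "'a set \<Rightarrow> ('a \<Rightarrow> 'a \<Rightarrow> real) \<Rightarrow> ('a \<Rightarrow> 'a) \<Rightarrow> bool" where
  "global_strongly_Picard X d T \<longleftrightarrow>
     (\<forall>x\<in>X. \<exists>z\<in>Fix_set X T. d_converges X d (\<lambda>n. (T ^^ n) x) z) \<and>
     (\<forall>z1\<in>Fix_set X T. \<forall>z2\<in>Fix_set X T. z1 = z2)"

definition B_cp_ms :: "'a itself \<Rightarrow> bool" where
  "B_cp_ms _ \<longleftrightarrow>
     (\<forall>(X :: 'a set) d T.
        X \<noteq> {} \<longrightarrow> Metric_space X d \<longrightarrow> T \<in> X \<rightarrow> X \<longrightarrow>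
        Metric_space.mcomplete X d \<longrightarrow>
        (\<exists>\<alpha>. 0 \<le> \<alpha> \<and> \<alpha> < 1 \<and> (\<forall>x\<in>X. \<forall>y\<in>X. d (T x) (T y) \<le> \<alpha> * d x y)) \<longrightarrow>
        global_strongly_Picard X d T)"

definition rel_omega :: "'a set \<Rightarrow> ('a \<times> 'a) set \<Rightarrow> ('a \<times> 'a) set" where
  "rel_omega X S =
     {(x, y). \<exists>(k::nat) (z :: nat \<Rightarrow> 'a). k \<ge> 2 \<and> (\<forall>i\<in>{1..k}. z i \<in> X) \<and>
        z 1 = x \<and> z k = y \<and> (\<forall>i\<in>{1..k - 1}. (z i, z (i + 1)) \<in> S)}"

definition rel_contractive ::
    "'a set \<Rightarrow> ('a \<Rightarrow> 'a \<Rightarrow> real) \<Rightarrow> ('a \<times> 'a) set \<Rightarrow> real \<Rightarrow> ('a \<Rightarrow> 'a) \<Rightarrow> bool" where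
  "rel_contractive X d S lam T \<longleftrightarrow>
     (\<forall>x\<in>X. \<forall>y\<in>X. (x, y) \<in> S \<longrightarrow> d (T x) (T y) \<le> lam * d x y)"

definition ascending :: "('a \<times> 'a) set \<Rightarrow> (nat \<Rightarrow> 'a) \<Rightarrow> bool" where
  "ascending S s \<longleftrightarrow> (\<forall>i. (s i, s (Suc i)) \<in> S)"

definition rel_complete ::
    "'a set \<Rightarrow> ('a \<Rightarrow> 'a \<Rightarrow> real) \<Rightarrow> ('a \<times> 'a) set \<Rightarrow> bool" where
  "rel_complete X d S \<longleftrightarrow>
     (\<forall>s. ascending S s \<longrightarrow> Metric_space.MCauchy X d s \<longrightarrow> (\<exists>z\<in>X. d_converges X d s z))"

definition almost_selfclosed ::
    "'a set \<Rightarrow> ('a \<Rightarrow> 'a \<Rightarrow> real) \<Rightarrow> ('a \<times> 'a) set \<Rightarrow> bool" where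
  "almost_selfclosed X d S \<longleftrightarrow>
     (\<forall>s z. range s \<subseteq> X \<longrightarrow> z \<in> X \<longrightarrow> ascending S s \<longrightarrow> d_converges X d s z \<longrightarrow>
        (\<exists>r :: nat \<Rightarrow> nat. strict_mono r \<and> (\<forall>n. (s (r n), z) \<in> S)))"

definition rel_increasing :: "'a set \<Rightarrow> ('a \<times> 'a) set \<Rightarrow> ('a \<Rightarrow> 'a) \<Rightarrow> bool" where
  "rel_increasing X S T \<longleftrightarrow> (\<forall>x\<in>X. \<forall>y\<in>X. (x, y) \<in> S \<longrightarrow> (T x, T y) \<in> S)"

definition progress_set :: "'a set \<Rightarrow> ('a \<Rightarrow> 'a) \<Rightarrow> ('a \<times> 'a) set \<Rightarrow> 'a set" where
  "progress_set X T R = {x \<in> X. (x, T x) \<in> R}"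

definition semi_progressive :: "'a set \<Rightarrow> ('a \<times> 'a) set \<Rightarrow> ('a \<Rightarrow> 'a) \<Rightarrow> bool" where
  "semi_progressive X R T \<longleftrightarrow> progress_set X T R \<noteq> {}"

definition rel_global_strongly_Picard ::
    "'a set \<Rightarrow> ('a \<Rightarrow> 'a \<Rightarrow> real) \<Rightarrow> ('a \<times> 'a) set \<Rightarrow> ('a \<Rightarrow> 'a) \<Rightarrow> bool" where
  "rel_global_strongly_Picard X d R T \<longleftrightarrow>
     (\<forall>x\<in>progress_set X T R. \<exists>z\<in>Fix_set X T. d_converges X d (\<lambda>n. (T ^^ n) x) z) \<and>
     (\<forall>z1\<in>Fix_set X T. \<forall>z2\<in>Fix_set X T. (z1, z2) \<in> R \<longrightarrow> z1 = z2)"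

definition AI_lin_rsms :: "'a itself \<Rightarrow> bool" where
  "AI_lin_rsms _ \<longleftrightarrow>
     (\<forall>(X :: 'a set) d S T.
        X \<noteq> {} \<longrightarrow> Metric_space X d \<longrightarrow>
        S \<subseteq> X \<times> X \<longrightarrow> refl_on X S \<longrightarrow> sym S \<longrightarrow> T \<in> X \<rightarrow> X \<longrightarrow>
        (\<exists>lam. 0 < lam \<and> lam < 1 \<and> rel_contractive X d S lam T) \<longrightarrow>
        rel_complete X d S \<and> almost_selfclosed X d S \<longrightarrow>
        rel_increasing X S T \<and> semi_progressive X (rel_omega X S) T \<longrightarrow>
        rel_global_strongly_Picard X d (rel_omega X S) T)"

end

theory Submission
  imports Defs
begin

text \<open>
  Banach's principle is the relational one for the full relation \<open>X \<times> X\<close>: every sequence is then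
  ascending, every point is progressive, and \<open>\<omega>\<close>-comparable fixed points are just fixed points.

  Conversely, a map that contracts \<open>d\<close> along the edges of \<open>S\<close> is a genuine contraction for
  another metric. Let \<open>e x y\<close> be the infimum of the \<open>d\<close>-lengths of the \<open>S\<close>-chains from \<open>x\<close> to
  \<open>y\<close>. It is a metric on each class of points joined by chains; it dominates \<open>d\<close> and agrees with
  \<open>d\<close> on the edges of \<open>S\<close>. Since \<open>T\<close> sends a chain of length \<open>L\<close> to a chain of length at most
  \<open>\<lambda> L\<close>, it satisfies \<open>e (T x) (T y) \<le> \<lambda> * e x y\<close>. A class containing a point \<open>a\<close>
  together with \<open>T a\<close> is invariant under \<open>T\<close>, so Banach's principle applies there as soon as the
  class is \<open>e\<close>-complete. The classes of progressive points then give the convergence of the orbits,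
  and the class of a fixed point gives uniqueness.

  The completeness of \<open>e\<close> (\<open>mcomplete_chain_dist\<close>) is the heart of the matter, because the two
  hypotheses on \<open>S\<close> speak only of ascending sequences. An \<open>e\<close>-Cauchy sequence has a subsequence
  whose consecutive terms are joined by chains of summable lengths. Concatenating these chains yields
  an ascending sequence of finite total length, which has a \<open>d\<close>-limit \<open>z\<close> by relative
  completeness. Almost-selfclosedness joins a subsequence to \<open>z\<close> by single edges, on which \<open>e\<close>
  and \<open>d\<close> agree; hence \<open>z\<close> is also the \<open>e\<close>-limit.
\<close>

section \<open>Concatenating finite blocks into a sequence\<close>

lemma sum_blocks:
  fixes f :: "nat \<Rightarrow> real" and K :: "nat \<Rightarrow> nat"
  shows "(\<Sum>m<sum K {..<n}. f m) = (\<Sum>j<n. \<Sum>i<K j. f (sum K {..<j} + i))"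
proof -
  have split: "sum f {..<a + k} = sum f {..<a} + (\<Sum>i<k. f (a + i))" for a k :: nat
    by (induction k) auto
  show ?thesis
    by (induction n) (auto simp: split)
qed

text \<open>
  Block \<open>n\<close> of an infinite concatenation has length \<open>K n\<close> and starts at \<open>sum K {..<n}\<close>. Every
  position lies in exactly one block, which is why a sequence may be prescribed block by block.
\<close>
lemma block_position:
  fixes K :: "nat \<Rightarrow> nat"
  assumes K: "\<And>n. 0 < K n"
  shows "\<exists>n i. i < K n \<and> m = sum K {..<n} + i"
proof (induction m)
  case 0
  show ?case
    using K[of 0] by (intro exI[of _ 0]) auto
next
  case (Suc m)
  then obtain n i where ni: "i < K n" "m = sum K {..<n} + i"
    by blast
  show ?case
  proof (cases "Suc i < K n")
    case True
    then show ?thesis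
      using ni by (intro exI[of _ n] exI[of _ "Suc i"]) auto
  next
    case False
    then have "Suc i = K n"
      using ni by simp
    then show ?thesis
      using ni K by (intro exI[of _ "Suc n"] exI[of _ 0]) auto
  qed
qed

lemma block_position_unique:
  fixes K :: "nat \<Rightarrow> nat"
  assumes i: "i < K n" and i': "i' < K n'"
    and eq: "sum K {..<n} + i = sum K {..<n'} + i'"
  shows "n = n' \<and> i = i'"
proof -
  have gap: "sum K {..<a} + K a \<le> sum K {..<b}" if "a < b" for a b
    using sum_mono2[of "{..<b}" "{..<Suc a}" K] that by auto
  have "n = n'"
    using gap[of n n'] gap[of n' n] i i' eq by (cases n n' rule: linorder_cases) auto
  then show ?thesis
    using eq by simp
qed

text \<open>
  The conclusion includes \<open>i = K n\<close>: the last vertex of a block is the first vertex of the next, so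
  each step from one position to the next can be read off inside a single block.
\<close>
lemma concatenate_blocks:
  fixes K :: "nat \<Rightarrow> nat" and c :: "nat \<Rightarrow> nat \<Rightarrow> 'b"
  assumes K: "\<And>n. 0 < K n"
    and joint: "\<And>n. c n (K n) = c (Suc n) 0"
  obtains w where "\<And>n i. i \<le> K n \<Longrightarrow> w (sum K {..<n} + i) = c n i"
proof -
  have "\<exists>v. \<forall>n i. i < K n \<longrightarrow> m = sum K {..<n} + i \<longrightarrow> v = c n i" for m
  proof -
    obtain n i where "i < K n" "m = sum K {..<n} + i"
      using block_position[of K] K by blast
    then show ?thesis
      using block_position_unique[of i K n] by (intro exI[of _ "c n i"]) auto
  qed
  then obtain w where w: "\<And>m n i. i < K n \<Longrightarrow> m = sum K {..<n} + i \<Longrightarrow> w m = c n i"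
    by metis
  have "w (sum K {..<n} + i) = c n i" if "i \<le> K n" for n i
  proof (cases "i < K n")
    case True
    then show ?thesis
      using w by blast
  next
    case False
    then have "i = K n"
      using that by simp
    then show ?thesis
      using w[of 0 "Suc n" "sum K {..<n} + i"] K joint[of n] by simp
  qed
  then show thesis
    using that by blast
qed

section \<open>Fast Cauchy sequences\<close>

lemma (in Metric_space) summable_steps_imp_MCauchy:
  assumes ran: "range w \<subseteq> M" and sm: "summable (\<lambda>n. d (w n) (w (Suc n)))"
  shows "MCauchy w"
  unfolding MCauchy_def
proof (intro conjI strip ran)
  fix \<epsilon> :: real
  assume "\<epsilon> > 0"
  then obtain N where N: "\<And>m n. m \<ge> N \<Longrightarrow> norm (\<Sum>j=m..<n. d (w j) (w (Suc j))) < \<epsilon>"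
    using sm unfolding summable_Cauchy by blast
  have path: "d (w m) (w n) \<le> (\<Sum>j=m..<n. d (w j) (w (Suc j)))" if "m \<le> n" for m n
    using that
  proof (induction n rule: dec_induct)
    case base
    then show ?case
      using ran by (simp add: image_subset_iff)
  next
    case (step n)
    have "d (w m) (w (Suc n)) \<le> d (w m) (w n) + d (w n) (w (Suc n))"
      using ran by (intro triangle) auto
    then show ?case
      using step by simp
  qed
  have "d (w m) (w n) < \<epsilon>" if "m \<ge> N" "m \<le> n" for m n
    using path[OF that(2)] N[OF that(1), of n] by auto
  then have "\<forall>n n'. N \<le> n \<longrightarrow> N \<le> n' \<longrightarrow> d (w n) (w n') < \<epsilon>"
    by (metis commute nle_le)
  then show "\<exists>N. \<forall>n n'. N \<le> n \<longrightarrow> N \<le> n' \<longrightarrow> d (w n) (w n') < \<epsilon>" ..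
qed

lemma (in Metric_space) MCauchy_fast_subsequence:
  assumes "MCauchy s"
  obtains p where "strict_mono p" "\<And>n. d (s (p n)) (s (p (Suc n))) < (1/2) ^ n"
proof -
  have "\<exists>p. \<forall>n. (\<forall>i\<ge>p n. \<forall>j\<ge>p n. d (s i) (s j) < (1/2) ^ n) \<and> p n < p (Suc n)"
  proof (rule dependent_nat_choice)
    have ex: "\<exists>N. \<forall>i\<ge>N. \<forall>j\<ge>N. d (s i) (s j) < (1/2) ^ n" for n :: nat
    proof -
      have "(1/2) ^ n > (0::real)"
        by simp
      then show ?thesis
        using assms unfolding MCauchy_def by metis
    qed
    show "\<exists>k. \<forall>i\<ge>k. \<forall>j\<ge>k. d (s i) (s j) < (1/2) ^ 0"
      by (rule ex)
    fix k :: nat and n :: nat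
    obtain N where "\<forall>i\<ge>N. \<forall>j\<ge>N. d (s i) (s j) < (1/2) ^ Suc n"
      using ex by blast
    then show "\<exists>k'. (\<forall>i\<ge>k'. \<forall>j\<ge>k'. d (s i) (s j) < (1/2) ^ Suc n) \<and> k < k'"
      by (intro exI[of _ "max N (Suc k)"]) auto
  qed
  then obtain p where p: "\<And>n i j. p n \<le> i \<Longrightarrow> p n \<le> j \<Longrightarrow> d (s i) (s j) < (1/2) ^ n"
      "\<And>n. p n < p (Suc n)"
    by blast
  show thesis
    by (rule that[of p]) (use p in \<open>auto simp: strict_mono_Suc_iff less_imp_le\<close>)
qed

section \<open>The chain metric\<close>

locale rs_relational_metric_space = Metric_space X d
  for X :: "'a set" and d :: "'a \<Rightarrow> 'a \<Rightarrow> real" +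
  fixes S :: "('a \<times> 'a) set"
  assumes S_carrier: "S \<subseteq> X \<times> X"
    and S_refl: "refl_on X S"
    and S_sym: "sym S"
begin

text \<open>
  \<open>chain x y L\<close> says that \<open>x\<close> and \<open>y\<close> are joined by an \<open>S\<close>-path of \<open>d\<close>-length \<open>L\<close>. Paths have
  at least one edge, as in \<^const>\<open>rel_omega\<close>; this also keeps the blocks nonempty when paths
  are concatenated.
\<close>
inductive chain :: "'a \<Rightarrow> 'a \<Rightarrow> real \<Rightarrow> bool" where
  single: "(x, y) \<in> S \<Longrightarrow> chain x y (d x y)"
| Cons: "(x, y) \<in> S \<Longrightarrow> chain y z L \<Longrightarrow> chain x z (d x y + L)"

text \<open>
  The value 0 for unlinked points makes the function nonnegative and symmetric on the whole type, as
  \<^locale>\<open>Metric_space\<close> demands even outside its carrier.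
\<close>
definition chain_dist :: "'a \<Rightarrow> 'a \<Rightarrow> real" where
  "chain_dist x y = (if \<exists>L. chain x y L then Inf {L. chain x y L} else 0)"

definition chain_class :: "'a \<Rightarrow> 'a set" where
  "chain_class x = {y. \<exists>L. chain x y L}"

lemma chain_in_X: "chain x y L \<Longrightarrow> x \<in> X \<and> y \<in> X"
  by (induction rule: chain.induct) (use S_carrier in auto)

lemma chain_refl: "x \<in> X \<Longrightarrow> chain x x 0"
  using chain.single[of x x] S_refl by (auto simp: refl_on_def)

lemma chain_trans: "chain x y L \<Longrightarrow> chain y z L' \<Longrightarrow> chain x z (L + L')"
  by (induction rule: chain.induct) (auto simp: add.assoc intro: chain.Cons)

lemma chain_sym: "chain x y L \<Longrightarrow> chain y x L"
proof (induction rule: chain.induct)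
  case (single x y)
  then show ?case
    using S_sym chain.single[of y x] by (auto simp: commute sym_def)
next
  case (Cons x y z L)
  have "chain y x (d x y)"
    using S_sym chain.single[of y x] Cons(1) by (auto simp: commute sym_def)
  then show ?case
    using chain_trans[OF Cons.IH, of x "d x y"] by (simp add: add.commute)
qed

lemma dist_le_chain: "chain x y L \<Longrightarrow> d x y \<le> L"
proof (induction rule: chain.induct)
  case (Cons x y z L)
  have "d x z \<le> d x y + d y z"
    using chain_in_X[OF Cons(2)] Cons(1) S_carrier by (intro triangle) auto
  then show ?case
    using Cons by simp
qed auto

lemma chain_along_sequence:
  assumes "a < b" and "\<And>i. a \<le> i \<Longrightarrow> i < b \<Longrightarrow> (w i, w (Suc i)) \<in> S"
  shows "\<exists>L. chain (w a) (w b) L"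
  using assms
proof (induction b)
  case (Suc b)
  have last: "chain (w b) (w (Suc b)) (d (w b) (w (Suc b)))"
    using Suc.prems by (intro chain.single) auto
  show ?case
  proof (cases "a = b")
    case True
    then show ?thesis
      using last by blast
  next
    case False
    then have "\<exists>L. chain (w a) (w b) L"
      using Suc by auto
    then show ?thesis
      using chain_trans last by blast
  qed
qed simp

lemma chain_vertices:
  assumes "chain x y L"
  shows "\<exists>K c. 0 < K \<and> c 0 = x \<and> c K = y \<and> (\<forall>i<K. (c i, c (Suc i)) \<in> S) \<and>
           L = (\<Sum>i<K. d (c i) (c (Suc i)))"
  using assms
proof (induction rule: chain.induct)
  case (single x y)
  then show ?case
    by (intro exI[of _ 1] exI[of _ "\<lambda>i. if i = 0 then x else y"]) auto
next
  case (Cons x y z L)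
  then obtain K c where "0 < K" "c 0 = y" "c K = z" "\<forall>i<K. (c i, c (Suc i)) \<in> S"
      "L = (\<Sum>i<K. d (c i) (c (Suc i)))"
    by blast
  then show ?case
    using Cons(1)
    by (intro exI[of _ "Suc K"] exI[of _ "case_nat x c"])
       (auto simp: less_Suc_eq_0_disj sum.lessThan_Suc_shift simp del: sum.lessThan_Suc)
qed

lemma rel_omega_iff_chain: "(x, y) \<in> rel_omega X S \<longleftrightarrow> (\<exists>L. chain x y L)"
proof
  assume "(x, y) \<in> rel_omega X S"
  then obtain k :: nat and z where "2 \<le> k" "z 1 = x" "z k = y"
      "\<forall>i\<in>{1..k - 1}. (z i, z (i + 1)) \<in> S"
    unfolding rel_omega_def by blast
  then show "\<exists>L. chain x y L"
    using chain_along_sequence[of 1 k z] by auto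
next
  assume "\<exists>L. chain x y L"
  then obtain K c where c: "0 < K" "c 0 = x" "c K = y" "\<forall>i<K. (c i, c (Suc i)) \<in> S"
    using chain_vertices by blast
  have cX: "c i \<in> X" if "i \<le> K" for i
  proof (cases i)
    case 0
    then show ?thesis
      using c(1,2,4) S_carrier by blast
  next
    case (Suc j)
    then have "(c j, c i) \<in> S"
      using c(4) that by simp
    then show ?thesis
      using S_carrier by blast
  qed
  show "(x, y) \<in> rel_omega X S"
    unfolding rel_omega_def mem_Collect_eq prod.case
  proof (intro exI conjI)
    show "2 \<le> Suc K" using c by simp
    show "\<forall>i\<in>{1..Suc K}. c (i - 1) \<in> X" using cX by auto
    show "\<forall>i\<in>{1..Suc K - 1}. (c (i - 1), c (i + 1 - 1)) \<in> S"
    proof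
      fix i assume "i \<in> {1..Suc K - 1}"
      then show "(c (i - 1), c (i + 1 - 1)) \<in> S"
        using c(4) by (cases i) auto
    qed
  qed (use c in auto)
qed

lemma chain_dist_le: "chain x y L \<Longrightarrow> chain_dist x y \<le> L"
  unfolding chain_dist_def
  by (auto intro!: cInf_lower bdd_belowI[of _ "d x y"] dist_le_chain)

lemma chain_dist_greatest:
  "chain x y K \<Longrightarrow> (\<And>L. chain x y L \<Longrightarrow> b \<le> L) \<Longrightarrow> b \<le> chain_dist x y"
  unfolding chain_dist_def by (auto intro!: cInf_greatest)

lemma chain_dist_lessD:
  "chain x y K \<Longrightarrow> chain_dist x y < b \<Longrightarrow> \<exists>L<b. chain x y L"
  by (meson chain_dist_greatest not_le)

lemma dist_le_chain_dist: "chain x y L \<Longrightarrow> d x y \<le> chain_dist x y"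
  by (blast intro: chain_dist_greatest dist_le_chain)

text \<open>
  A single edge is a shortest chain by the triangle inequality. Hence a step along \<open>S\<close> costs the
  same in both metrics, which is what lets limits pass from one to the other.
\<close>
lemma chain_dist_eq_dist: "(x, y) \<in> S \<Longrightarrow> chain_dist x y = d x y"
  by (meson antisym chain.single chain_dist_le dist_le_chain_dist)

lemma chain_class_linked:
  assumes "x \<in> chain_class a" "y \<in> chain_class a"
  shows "\<exists>L. chain x y L"
  using assms unfolding chain_class_def by (blast intro: chain_trans chain_sym)

lemma chain_class_subset: "chain_class a \<subseteq> X"
  unfolding chain_class_def using chain_in_X by blast

lemma chain_class_closed: "x \<in> chain_class a \<Longrightarrow> chain x y L \<Longrightarrow> y \<in> chain_class a"
  unfolding chain_class_def by (blast intro: chain_trans)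

lemma mem_chain_class_self: "a \<in> X \<Longrightarrow> a \<in> chain_class a"
  unfolding chain_class_def using chain_refl by blast

lemma Metric_space_chain_dist: "Metric_space (chain_class a) chain_dist"
proof
  show "0 \<le> chain_dist x y" for x y
  proof (cases "\<exists>L. chain x y L")
    case True
    then show ?thesis
      using dist_le_chain_dist nonneg order_trans by blast
  qed (simp add: chain_dist_def)
  have "chain x y = chain y x" for x y
    using chain_sym by blast
  then show "chain_dist x y = chain_dist y x" for x y
    unfolding chain_dist_def by metis
next
  fix x y
  assume xy: "x \<in> chain_class a" "y \<in> chain_class a"
  then obtain L where "chain x y L"
    using chain_class_linked by blast
  then have "d x y \<le> chain_dist x y" "x \<in> X" "y \<in> X"
    using dist_le_chain_dist chain_in_X by blast+
  then show "chain_dist x y = 0 \<longleftrightarrow> x = y"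
    using chain_dist_eq_dist[of x x] S_refl zero nonneg[of x y]
    by (auto simp: refl_on_def simp del: nonneg)
next
  fix x y z
  assume xyz: "x \<in> chain_class a" "y \<in> chain_class a" "z \<in> chain_class a"
  obtain L0 M0 where 0: "chain x y L0" "chain y z M0"
    using chain_class_linked xyz by meson
  have "chain_dist x z - M \<le> chain_dist x y" if "chain y z M" for M
  proof (rule chain_dist_greatest[OF 0(1)])
    fix L
    assume "chain x y L"
    then show "chain_dist x z - M \<le> L"
      using chain_dist_le[OF chain_trans[OF _ that]] by force
  qed
  then have "chain_dist x z - chain_dist x y \<le> chain_dist y z"
    by (intro chain_dist_greatest[OF 0(2)]) (simp add: algebra_simps)
  then show "chain_dist x z \<le> chain_dist x y + chain_dist y z"
    by simp
qed

text \<open>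
  In each gap there is a chain shorter than \<open>(1/2) ^ n\<close>, by definition of the infimum; the
  concatenation of all of them has total length at most the sum of the geometric series.
\<close>
lemma ascending_interpolation:
  assumes linked: "\<And>n. \<exists>L. chain (s n) (s (Suc n)) L"
    and step: "\<And>n. chain_dist (s n) (s (Suc n)) < (1/2) ^ n"
  obtains w r where "ascending S w" "strict_mono r" "\<And>n. w (r n) = s n"
    "summable (\<lambda>m. d (w m) (w (Suc m)))"
proof -
  define P where "P n K c \<longleftrightarrow> 0 < K \<and> c 0 = s n \<and> c K = s (Suc n) \<and>
      (\<forall>i<K. (c i, c (Suc i)) \<in> S) \<and> (\<Sum>i<K. d (c i) (c (Suc i))) < (1/2) ^ n"
    for n and K :: nat and c
  have "\<forall>n. \<exists>K c. P n K c"
  proof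
    fix n
    obtain L where "chain (s n) (s (Suc n)) L" "L < (1/2) ^ n"
      using chain_dist_lessD linked step by meson
    then show "\<exists>K c. P n K c"
      using chain_vertices unfolding P_def by blast
  qed
  then obtain K c where "\<And>n. P n (K n) (c n)"
    by metis
  then have K: "\<And>n. 0 < K n" and c0: "\<And>n. c n 0 = s n"
    and cK: "\<And>n. c n (K n) = s (Suc n)"
    and cS: "\<And>n i. i < K n \<Longrightarrow> (c n i, c n (Suc i)) \<in> S"
    and len: "\<And>n. (\<Sum>i<K n. d (c n i) (c n (Suc i))) < (1/2) ^ n"
    unfolding P_def by auto
  obtain w where w: "\<And>n i. i \<le> K n \<Longrightarrow> w (sum K {..<n} + i) = c n i"
    using concatenate_blocks[of K c] K c0 cK by metis
  let ?f = "\<lambda>m. d (w m) (w (Suc m))"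
  have w_Suc: "w (Suc (sum K {..<n} + i)) = c n (Suc i)" if "i < K n" for n i
    using w[of "Suc i" n] that by simp
  have "ascending S w"
    unfolding ascending_def
  proof
    fix m
    obtain n i where "i < K n" "m = sum K {..<n} + i"
      using block_position[of K] K by blast
    then show "(w m, w (Suc m)) \<in> S"
      using w[of i n] w_Suc[of i n] cS by simp
  qed
  moreover have mono: "strict_mono (\<lambda>n. sum K {..<n})"
    using K by (simp add: strict_mono_Suc_iff)
  moreover have "w (sum K {..<n}) = s n" for n
    using w[of 0 n] c0 by simp
  moreover have "summable ?f"
  proof (rule summableI_nonneg_bounded)
    show "0 \<le> ?f m" for m
      by simp
    fix m
    (* As blocks are nonempty, the first m steps lie within the first m blocks. *)
    have "m \<le> sum K {..<m}"
      using strict_mono_imp_increasing[OF mono, of m] .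
    then have "(\<Sum>j<m. ?f j) \<le> (\<Sum>j<sum K {..<m}. ?f j)"
      by (intro sum_mono2) auto
    also have "\<dots> = (\<Sum>n<m. \<Sum>i<K n. d (c n i) (c n (Suc i)))"
      unfolding sum_blocks by (intro sum.cong refl) (simp add: w w_Suc)
    also have "\<dots> \<le> (\<Sum>n<m. (1/2) ^ n)"
      by (intro sum_mono less_imp_le len)
    also have "\<dots> \<le> (\<Sum>n. (1/2) ^ n :: real)"
      by (intro sum_le_suminf summable_geometric) auto
    finally show "(\<Sum>j<m. ?f j) \<le> (\<Sum>n. (1/2) ^ n)" .
  qed
  ultimately show thesis
    using that by blast
qed

text \<open>
  The interpolating sequence \<open>w\<close> serves both metrics: its finite total length makes it Cauchy for
  \<open>d\<close> and for \<open>chain_dist\<close>. It therefore suffices to find the limit for \<open>d\<close>, transfer it along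
  the subsequence that is joined to it by edges, and return through Cauchyness, first to \<open>w\<close> and
  then to the original sequence.
\<close>
lemma mcomplete_chain_dist:
  assumes complete: "rel_complete X d S" and closed: "almost_selfclosed X d S"
  shows "Metric_space.mcomplete (chain_class a) chain_dist"
proof -
  interpret C: Metric_space "chain_class a" chain_dist
    by (rule Metric_space_chain_dist)
  show ?thesis
    unfolding C.mcomplete_def
  proof (intro strip)
    fix s
    assume s: "C.MCauchy s"
    then have sC: "s n \<in> chain_class a" for n
      unfolding C.MCauchy_def by blast
    obtain p where p: "strict_mono p"
        "\<And>n. chain_dist (s (p n)) (s (p (Suc n))) < (1/2) ^ n"
      using C.MCauchy_fast_subsequence[OF s] by blast
    obtain w r where w: "ascending S w" and r: "strict_mono r" "\<And>n. w (r n) = s (p n)"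
      and sm: "summable (\<lambda>m. d (w m) (w (Suc m)))"
      using ascending_interpolation[of "\<lambda>n. s (p n)"] chain_class_linked sC p(2) by metis
    have wS: "(w i, w (Suc i)) \<in> S" for i
      using w unfolding ascending_def by blast
    have wX: "range w \<subseteq> X"
      using wS S_carrier by blast
    (* w m is linked to the later term w (r (Suc m)) of the given sequence. *)
    have wC: "w m \<in> chain_class a" for m
    proof -
      have "m < r (Suc m)"
        using strict_mono_imp_increasing[OF r(1), of "Suc m"] by simp
      then have "\<exists>L. chain (w m) (w (r (Suc m))) L"
        using wS by (intro chain_along_sequence)
      then show ?thesis
        using chain_sym chain_class_closed sC r(2) by metis
    qed
    have "MCauchy w"
      using wX sm by (rule summable_steps_imp_MCauchy)
    then obtain z where z: "z \<in> X" "d_converges X d w z"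
      using complete w unfolding rel_complete_def by blast
    then obtain q :: "nat \<Rightarrow> nat" where q: "strict_mono q" "\<And>n. (w (q n), z) \<in> S"
      using closed w wX unfolding almost_selfclosed_def by blast
    have zC: "z \<in> chain_class a"
      using chain_class_closed[OF wC chain.single[OF q(2)]] .
    have "C.MCauchy w"
      using wC sm by (intro C.summable_steps_imp_MCauchy) (auto simp: chain_dist_eq_dist wS)
    moreover have "limitin C.mtopology (w \<circ> q) z sequentially"
    proof -
      have "chain_dist (w (q n)) z = d (w (q n)) z" for n
        using q(2) by (rule chain_dist_eq_dist)
      moreover have "limitin mtopology (w \<circ> q) z sequentially"
        using z(2) unfolding d_converges_def by (rule limitin_subsequence[OF q(1)])
      ultimately show ?thesis
        using zC wC wX
        by (simp add: limit_metric_sequentially C.limit_metric_sequentially image_subset_iff)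
    qed
    ultimately have "limitin C.mtopology w z sequentially"
      by (rule C.MCauchy_convergent_subsequence[OF _ q(1)])
    then have "limitin C.mtopology (w \<circ> r) z sequentially"
      by (rule limitin_subsequence[OF r(1)])
    then have "limitin C.mtopology (s \<circ> p) z sequentially"
      by (simp add: o_def r(2))
    then show "\<exists>z. limitin C.mtopology s z sequentially"
      using C.MCauchy_convergent_subsequence[OF s p(1)] by blast
  qed
qed

lemma d_converges_if_chain_dist:
  assumes "d_converges (chain_class a) chain_dist s z"
  shows "d_converges X d s z"
proof -
  interpret C: Metric_space "chain_class a" chain_dist
    by (rule Metric_space_chain_dist)
  have lim: "limitin C.mtopology s z sequentially"
    using assms unfolding d_converges_def .
  have le: "d x z \<le> chain_dist x z" if "x \<in> chain_class a" for x
    using that lim chain_class_linked dist_le_chain_dist C.limit_metric_sequentially by metis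
  show ?thesis
    unfolding d_converges_def limit_metric_sequentially
  proof (intro conjI strip)
    show "z \<in> X"
      using lim chain_class_subset C.limit_metric_sequentially by blast
    fix \<epsilon> :: real
    assume "\<epsilon> > 0"
    then obtain N where "\<forall>n\<ge>N. s n \<in> chain_class a \<and> chain_dist (s n) z < \<epsilon>"
      using lim unfolding C.limit_metric_sequentially by blast
    then show "\<exists>N. \<forall>n\<ge>N. s n \<in> X \<and> d (s n) z < \<epsilon>"
      using le chain_class_subset by (meson le_less_trans subsetD)
  qed
qed

text \<open>
  Contractivity is only assumed on edges, but the image of a chain is again a chain because \<open>T\<close>
  preserves \<open>S\<close>, so the bound on edges adds up to a bound on lengths.
\<close>
lemma chain_image:
  assumes contr: "rel_contractive X d S lam T" and incr: "rel_increasing X S T"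
    and "chain x y L"
  shows "\<exists>L'. chain (T x) (T y) L' \<and> L' \<le> lam * L"
  using assms(3)
proof (induction rule: chain.induct)
  case (single x y)
  then show ?case
    using contr incr S_carrier unfolding rel_contractive_def rel_increasing_def
    by (blast intro: chain.single)
next
  case (Cons x y z L)
  then obtain L' where L': "chain (T y) (T z) L'" "L' \<le> lam * L"
    by blast
  have "(T x, T y) \<in> S" "d (T x) (T y) \<le> lam * d x y"
    using Cons(1) contr incr S_carrier unfolding rel_contractive_def rel_increasing_def by blast+
  then show ?case
    using L' by (intro exI[of _ "d (T x) (T y) + L'"]) (simp add: chain.Cons distrib_left)
qed

lemma chain_dist_contraction:
  assumes contr: "rel_contractive X d S lam T" and incr: "rel_increasing X S T"
    and lam: "0 < lam" and xy: "chain x y K"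
  shows "chain_dist (T x) (T y) \<le> lam * chain_dist x y"
proof -
  have "chain_dist (T x) (T y) / lam \<le> chain_dist x y"
  proof (rule chain_dist_greatest[OF xy])
    fix L
    assume "chain x y L"
    then have "chain_dist (T x) (T y) \<le> lam * L"
      using chain_image[OF contr incr] chain_dist_le order_trans by blast
    then show "chain_dist (T x) (T y) / lam \<le> L"
      using lam by (simp add: field_simps)
  qed
  then show ?thesis
    using lam by (simp add: field_simps)
qed

text \<open>
  The link from \<open>a\<close> to \<open>T a\<close> makes the class invariant: if \<open>a\<close> is joined to \<open>x\<close> then
  \<open>T a\<close> is joined to \<open>T x\<close>, hence so is \<open>a\<close>.
\<close>
lemma Picard_on_chain_class:
  fixes T :: "'a \<Rightarrow> 'a"
  assumes Banach: "B_cp_ms TYPE('a)"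
    and contr: "rel_contractive X d S lam T" and lam: "0 < lam" "lam < 1"
    and incr: "rel_increasing X S T"
    and complete: "rel_complete X d S" and closed: "almost_selfclosed X d S"
    and start: "chain a (T a) L0"
  shows "global_strongly_Picard (chain_class a) chain_dist T"
proof -
  have self: "T \<in> chain_class a \<rightarrow> chain_class a"
  proof
    fix x
    assume "x \<in> chain_class a"
    then obtain L where "chain a x L"
      unfolding chain_class_def by blast
    then show "T x \<in> chain_class a"
      using chain_image[OF contr incr] chain_trans[OF start] unfolding chain_class_def by blast
  qed
  have "\<forall>x\<in>chain_class a. \<forall>y\<in>chain_class a.
      chain_dist (T x) (T y) \<le> lam * chain_dist x y"
    using chain_class_linked chain_dist_contraction[OF contr incr lam(1)] by meson
  moreover have "chain_class a \<noteq> {}"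
    using mem_chain_class_self chain_in_X[OF start] by blast
  ultimately show ?thesis
    using Banach self lam Metric_space_chain_dist mcomplete_chain_dist[OF complete closed]
    unfolding B_cp_ms_def by (meson less_imp_le)
qed

end

section \<open>The two deductions\<close>

text \<open>
  Different points are treated in their own classes. A fixed point is joined to its image by
  reflexivity, so its class qualifies too and contains every fixed point comparable with it.
\<close>
lemma relational_contraction_from_Banach:
  assumes Banach: "B_cp_ms TYPE('a)"
  shows "AI_lin_rsms TYPE('a)"
  unfolding AI_lin_rsms_def
proof (intro allI impI, elim exE conjE)
  fix X :: "'a set" and d S T lam
  assume ms: "Metric_space X d" and S: "S \<subseteq> X \<times> X" "refl_on X S" "sym S"
    and lam: "0 < lam" "lam < 1" and contr: "rel_contractive X d S lam T"
    and complete: "rel_complete X d S" and closed: "almost_selfclosed X d S"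
    and incr: "rel_increasing X S T"
  interpret rs_relational_metric_space X d S
    using ms S by (simp add: rs_relational_metric_space_def rs_relational_metric_space_axioms_def)
  note Picard = Picard_on_chain_class[OF Banach contr lam incr complete closed]
  show "rel_global_strongly_Picard X d (rel_omega X S) T"
    unfolding rel_global_strongly_Picard_def
  proof (intro conjI ballI impI)
    fix x
    assume "x \<in> progress_set X T (rel_omega X S)"
    then obtain L where "x \<in> X" "chain x (T x) L"
      unfolding progress_set_def rel_omega_iff_chain by blast
    then obtain z where z: "z \<in> Fix_set (chain_class x) T"
        "d_converges (chain_class x) chain_dist (\<lambda>n. (T ^^ n) x) z"
      using Picard[of x L] mem_chain_class_self[of x] unfolding global_strongly_Picard_def
      by meson
    have "z \<in> Fix_set X T"
      using z(1) chain_class_subset[of x] unfolding Fix_set_def by blast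
    then show "\<exists>z\<in>Fix_set X T. d_converges X d (\<lambda>n. (T ^^ n) x) z"
      using d_converges_if_chain_dist[OF z(2)] by (rule bexI[rotated])
  next
    fix z1 z2
    assume z: "z1 \<in> Fix_set X T" "z2 \<in> Fix_set X T" "(z1, z2) \<in> rel_omega X S"
    then have "chain z1 (T z1) 0"
      using chain_refl unfolding Fix_set_def by simp
    moreover have "z1 \<in> Fix_set (chain_class z1) T" "z2 \<in> Fix_set (chain_class z1) T"
      using z mem_chain_class_self unfolding Fix_set_def rel_omega_iff_chain
      by (auto simp: chain_class_def)
    ultimately show "z1 = z2"
      using Picard[of z1 0] unfolding global_strongly_Picard_def by meson
  qed
qed

lemma Banach_from_relational_contraction:
  assumes AI: "AI_lin_rsms TYPE('a)"
  shows "B_cp_ms TYPE('a)"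
  unfolding B_cp_ms_def
proof (intro allI impI, elim exE conjE)
  fix X :: "'a set" and d T and \<alpha> :: real
  assume ne: "X \<noteq> {}" and ms: "Metric_space X d" and T: "T \<in> X \<rightarrow> X"
    and complete: "Metric_space.mcomplete X d"
    and \<alpha>: "0 \<le> \<alpha>" "\<alpha> < 1" "\<forall>x\<in>X. \<forall>y\<in>X. d (T x) (T y) \<le> \<alpha> * d x y"
  interpret Metric_space X d
    by (rule ms)
  let ?S = "X \<times> X"
  interpret R: rs_relational_metric_space X d ?S
    by unfold_locales (auto simp: refl_on_def sym_def)
  have omega: "rel_omega X ?S = ?S"
  proof (intro set_eqI)
    fix q :: "'a \<times> 'a"
    obtain x y where q: "q = (x, y)"
      by fastforce
    show "q \<in> rel_omega X ?S \<longleftrightarrow> q \<in> ?S"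
      unfolding q R.rel_omega_iff_chain using R.chain_in_X R.chain.single by blast
  qed
  (* The relational principle wants a positive constant, whereas \<alpha> may be 0. *)
  have "rel_contractive X d ?S (max \<alpha> (1/2)) T"
    unfolding rel_contractive_def
  proof (intro ballI impI)
    fix x y
    assume "x \<in> X" "y \<in> X"
    then have "d (T x) (T y) \<le> \<alpha> * d x y"
      using \<alpha>(3) by blast
    also have "\<dots> \<le> max \<alpha> (1/2) * d x y"
      by (intro mult_right_mono) auto
    finally show "d (T x) (T y) \<le> max \<alpha> (1/2) * d x y" .
  qed
  then have "\<exists>lam. 0 < lam \<and> lam < 1 \<and> rel_contractive X d ?S lam T"
    using \<alpha> by (intro exI[of _ "max \<alpha> (1/2)"]) auto
  moreover have "rel_complete X d ?S"
    using complete limitin_topspace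
    unfolding rel_complete_def mcomplete_def d_converges_def by fastforce
  moreover have "almost_selfclosed X d ?S"
    unfolding almost_selfclosed_def
    by (intro allI impI exI[of _ id]) (auto simp: strict_mono_def)
  moreover have "rel_increasing X ?S T"
    using T unfolding rel_increasing_def by auto
  moreover have progress: "progress_set X T (rel_omega X ?S) = X"
    using T unfolding progress_set_def omega by auto
  then have "semi_progressive X (rel_omega X ?S) T"
    using ne unfolding semi_progressive_def by simp
  ultimately have "rel_global_strongly_Picard X d (rel_omega X ?S) T"
    using AI ne ms T R.S_carrier R.S_refl R.S_sym unfolding AI_lin_rsms_def by blast
  then show "global_strongly_Picard X d T"
    unfolding rel_global_strongly_Picard_def global_strongly_Picard_def progress
    by (simp add: omega Fix_set_def)
qed

theorem proposition4p1:
  shows "(AI_lin_rsms TYPE('a) \<longrightarrow> B_cp_ms TYPE('a)) \<and>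
         (B_cp_ms TYPE('a) \<longrightarrow> AI_lin_rsms TYPE('a)) \<and>
         (B_cp_ms TYPE('a) \<longleftrightarrow> AI_lin_rsms TYPE('a))"
  using relational_contraction_from_Banach Banach_from_relational_contraction by blast

end
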